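(* Let $(Y_n)_n$, $(Y'_n)_n$ be two independent sequences of independent standard Gaussian random variables, and let $(c_k)_{k\ge0}\in\ell^2$ be a real sequence. Then the sequence of processes $$y^{(n)}_t=c_0Y'_0+\sum_{k=1}^{n}c_k\big(Y_k\sqrt2\sin(2k\pi t)+Y'_k\sqrt2\cos(2k\pi t)\big),\qquad t\in[0,1],$$ converges in mean square, uniformly in $t$, to a process $\{y_t\}_{t\in[0,1]}\in\mathscr{H}$. Moreover, if $C(s,t)$ is the covariance function of $\{y_t\}_{t\in[0,1]}$, then $$C(s,t)=c_0^2+\sum_{k=1}^{\infty}2c_k^2\cos(2k\pi(s-t)),$$ where the series converges uniformly, absolutely and in $L^2([0,1]\times[0,1])$.
   Context: $\mathscr{H}$ denotes the set of real Gaussian stochastic processes $\{x_t\}_{t\in[0,1]}$ such that: $E(x_t)=0$ for all $t$; the process is continuously stationary, i.e. its covariance function $C(s,t)=\mathrm{Cov}(x_s,x_t)$ satisfies $C(s,t)=\tilde C(s-t)$ for all $s,t$ for some real continuous function $\tilde C$ (the covariogram function); and the process is periodical, i.e. $x_0=x_1$ almost surely. Convergence of $y^{(n)}_t$ to $y_t$ in mean square, uniformly in $t$, means $\sup_{t\in[0,1]}E\big[(y_t-y^{(n)}_t)^2\big]\to0$ as $n\to\infty$. *)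

theory Defs
  imports "HOL-Probability.Probability"
begin

(* Point masses count as Gaussian (variance 0); normal_density is only a density for \<sigma> > 0. *)
definition gaussian_rv :: "'a measure \<Rightarrow> ('a \<Rightarrow> real) \<Rightarrow> bool" where
  "gaussian_rv M X \<longleftrightarrow> X \<in> borel_measurable M \<and>
     ((\<exists>\<mu> \<sigma>. \<sigma> > 0 \<and> distributed M lborel X (normal_density \<mu> \<sigma>)) \<or>
      (\<exists>\<mu>. AE \<omega> in M. X \<omega> = \<mu>))"

definition gaussian_process :: "'a measure \<Rightarrow> 'i set \<Rightarrow> ('i \<Rightarrow> 'a \<Rightarrow> real) \<Rightarrow> bool" where
  "gaussian_process M I x \<longleftrightarrow>
     (\<forall>T a. finite T \<longrightarrow> T \<subseteq> I \<longrightarrow> gaussian_rv M (\<lambda>\<omega>. \<Sum>t\<in>T. a t * x t \<omega>))"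

definition covariance :: "'a measure \<Rightarrow> ('a \<Rightarrow> real) \<Rightarrow> ('a \<Rightarrow> real) \<Rightarrow> real" where
  "covariance M X Y =
     (\<integral>\<omega>. (X \<omega> - (\<integral>\<omega>'. X \<omega>' \<partial>M)) * (Y \<omega> - (\<integral>\<omega>'. Y \<omega>' \<partial>M)) \<partial>M)"

definition covariance_fun :: "'a measure \<Rightarrow> ('i \<Rightarrow> 'a \<Rightarrow> real) \<Rightarrow> 'i \<Rightarrow> 'i \<Rightarrow> real" where
  "covariance_fun M x s t = covariance M (x s) (x t)"

definition continuously_stationary :: "'a measure \<Rightarrow> (real \<Rightarrow> 'a \<Rightarrow> real) \<Rightarrow> bool" where
  "continuously_stationary M x \<longleftrightarrow>
     (\<exists>C' :: real \<Rightarrow> real. continuous_on UNIV C' \<and>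
        (\<forall>s\<in>{0..1}. \<forall>t\<in>{0..1}. covariance_fun M x s t = C' (s - t)))"

(* The class \<H> of processes indexed by [0,1]; values of x outside [0,1] are irrelevant. *)
definition stationary_periodic_gaussian ::
    "'a measure \<Rightarrow> (real \<Rightarrow> 'a \<Rightarrow> real) \<Rightarrow> bool" where
  "stationary_periodic_gaussian M x \<longleftrightarrow>
     gaussian_process M {0..1} x \<and>
     (\<forall>t\<in>{0..1}. (\<integral>\<omega>. x t \<omega> \<partial>M) = 0) \<and>
     continuously_stationary M x \<and>
     (AE \<omega> in M. x 0 \<omega> = x 1 \<omega>)"

(* Stated in ennreal so that infinite second moments and unbounded suprema are not
   hidden by the conventions for Bochner integrals and real-valued suprema. *)
definition mean_square_uniform_limit ::
    "'a measure \<Rightarrow> (nat \<Rightarrow> real \<Rightarrow> 'a \<Rightarrow> real) \<Rightarrow> (real \<Rightarrow> 'a \<Rightarrow> real) \<Rightarrow> bool" where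
  "mean_square_uniform_limit M yn y \<longleftrightarrow>
     (\<lambda>n. SUP t\<in>{0..1}. \<integral>\<^sup>+\<omega>. ennreal ((y t \<omega> - yn n t \<omega>)\<^sup>2) \<partial>M) \<longlonglongrightarrow> 0"

definition square_integrable_on :: "'b measure \<Rightarrow> 'b set \<Rightarrow> ('b \<Rightarrow> real) \<Rightarrow> bool" where
  "square_integrable_on N A f \<longleftrightarrow>
     set_borel_measurable N A f \<and> set_integrable N A (\<lambda>x. (f x)\<^sup>2)"

definition L2_limit_on :: "'b measure \<Rightarrow> 'b set \<Rightarrow> (nat \<Rightarrow> 'b \<Rightarrow> real) \<Rightarrow> ('b \<Rightarrow> real) \<Rightarrow> bool" where
  "L2_limit_on N A fn f \<longleftrightarrow>
     (\<forall>n. square_integrable_on N A (fn n)) \<and> square_integrable_on N A f \<and>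
     (\<lambda>n. \<integral>\<^sup>+x\<in>A. ennreal ((f x - fn n x)\<^sup>2) \<partial>N) \<longlonglongrightarrow> 0"

definition trig_process ::
    "(nat \<Rightarrow> real) \<Rightarrow> (nat \<Rightarrow> 'a \<Rightarrow> real) \<Rightarrow> (nat \<Rightarrow> 'a \<Rightarrow> real) \<Rightarrow> nat \<Rightarrow> real \<Rightarrow> 'a \<Rightarrow> real" where
  "trig_process c Y Y' n t \<omega> =
     c 0 * Y' 0 \<omega> +
     (\<Sum>k=1..n. c k * (Y k \<omega> * sqrt 2 * sin (2 * real k * pi * t)
                     + Y' k \<omega> * sqrt 2 * cos (2 * real k * pi * t)))"

end

theory Submission
  imports Defs
begin

text \<open>
  A centred Gaussian variable of variance \<open>v\<close>, including the degenerate case \<open>v = 0\<close>, is exactly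
  one with characteristic function \<open>exp (- v u^2 / 2)\<close>.  Everything about the process follows from
  tracking the variance of its finite linear combinations through this one formula.

  For the partial sums, a combination \<open>\<Sum>i. w i * y_n (\<tau> i)\<close> is a linear combination of independent standard
  normals, so its characteristic function is a product and has the above form; with amplitudes
  \<open>e 0 = c 0\<close> and \<open>e k = sqrt 2 * c k\<close> for \<open>k > 0\<close>, its variance is \<open>\<Sum>k\<le>n. (e k)^2 * q k\<close>, where
  \<open>q k = (\<Sum>i. w i * sin (2 k pi \<tau> i))^2 + (\<Sum>i. w i * cos (2 k pi \<tau> i))^2\<close>
  (\<open>centered_gaussian_trig_process_lincomb\<close>).  The increment from \<open>n\<close> to \<open>m\<close> at a time \<open>t\<close> has variance
  \<open>\<Sum>k=n+1..m. (e k)^2\<close>, because \<open>sin^2 + cos^2 = 1\<close>.  This is bounded by a tail of a convergent series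
  that does not depend on \<open>t\<close>, so completeness of \<open>L^2\<close> yields a limit \<open>y t\<close> at every \<open>t\<close>, with convergence
  uniform in \<open>t\<close> (\<open>mean_square_Cauchy_imp_limit\<close>, \<open>trig_process_mean_square_limit\<close>).

  Centred Gaussian laws are preserved by mean-square limits
  (\<open>centered_gaussian_mean_square_limit\<close>), so each finite combination of \<open>y\<close> is centred Gaussian
  with variance \<open>\<Sum>k. (e k)^2 * q k\<close>.  The covariance is the polarization of this quadratic form
  (\<open>covariance_fun_limit\<close>), and the addition theorem for the cosine turns it into
  \<open>\<Sum>k. (e k)^2 * cos (2 k pi (s - t))\<close>.  This series is dominated by \<open>\<Sum>k. (e k)^2\<close>: by the Weierstrass
  test it converges absolutely and uniformly, its sum is continuous in \<open>s - t\<close>, and on the compact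
  square uniform convergence implies convergence in \<open>L^2\<close>.
\<close>

section \<open>Centred Gaussian variables via characteristic functions\<close>

text \<open>
  Defining the law by its characteristic function treats \<open>v > 0\<close> and the point mass at \<open>v = 0\<close>
  uniformly, which a density cannot do; sums and limits then need no case distinction.
\<close>

definition centered_gaussian :: "'a measure \<Rightarrow> real \<Rightarrow> ('a \<Rightarrow> real) \<Rightarrow> bool" where
  "centered_gaussian M v X \<longleftrightarrow> X \<in> borel_measurable M \<and> 0 \<le> v \<and>
     (\<forall>u. char (distr M borel X) u = complex_of_real (exp (- (v * u\<^sup>2) / 2)))"

lemma char_distr_cmult:
  assumes [measurable]: "X \<in> borel_measurable M"
  shows "char (distr M borel (\<lambda>\<omega>. a * X \<omega>)) u = char (distr M borel X) (a * u)"
  by (simp add: char_def integral_distr ac_simps)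

lemma cmod_iexp_diff_le: "cmod (iexp x - iexp y) \<le> \<bar>x - y\<bar>"
proof -
  have "iexp x - iexp y = iexp y * (iexp (x - y) - 1)"
    by (simp add: algebra_simps flip: exp_add)
  then have "cmod (iexp x - iexp y) = cmod (iexp (x - y) - 1)"
    by (simp only: norm_mult norm_exp_i_times mult_1)
  also have "\<dots> \<le> \<bar>x - y\<bar>"
    using iexp_approx1[of "x - y" 0] by simp
  finally show ?thesis .
qed

context prob_space
begin

text \<open>
  After scaling by \<open>1 / sqrt v\<close> the characteristic function is that of the standard normal
  distribution, so Levy's uniqueness theorem identifies the law.
\<close>

lemma centered_gaussian_distributed:
  assumes X: "centered_gaussian M v X" and "v > 0"
  shows "distributed M lborel X (normal_density 0 (sqrt v))"
proof -
  have [measurable]: "X \<in> borel_measurable M"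
    using X by (simp add: centered_gaussian_def)
  let ?Z = "\<lambda>\<omega>. (1 / sqrt v) * X \<omega>"
  have "distr M borel ?Z = std_normal_distribution"
  proof (rule Levy_uniqueness)
    show "real_distribution (distr M borel ?Z)"
      by (rule real_distribution_distr) simp
    show "char (distr M borel ?Z) = char std_normal_distribution"
    proof
      fix u
      have "char (distr M borel ?Z) u = char (distr M borel X) (1 / sqrt v * u)"
        by (rule char_distr_cmult) simp
      also have "\<dots> = complex_of_real (exp (- (v * (1 / sqrt v * u)\<^sup>2) / 2))"
        using X unfolding centered_gaussian_def by blast
      also have "v * (1 / sqrt v * u)\<^sup>2 = u\<^sup>2"
        using \<open>v > 0\<close> by (simp add: power_mult_distrib power_divide)
      finally show "char (distr M borel ?Z) u = char std_normal_distribution u"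
        by (simp add: char_std_normal_distribution)
    qed
  qed (rule real_dist_normal_dist)
  then have "distributed M lborel ?Z std_normal_density"
    by (auto simp: distributed_def cong: distr_cong)
  then show ?thesis
    using normal_standard_normal_convert[of "sqrt v" X 0] \<open>v > 0\<close> by (simp add: mult.commute divide_inverse)
qed

lemma centered_gaussian_AE_zero:
  assumes X: "centered_gaussian M 0 X"
  shows "AE \<omega> in M. X \<omega> = 0"
proof -
  have [measurable]: "X \<in> borel_measurable M"
    using X by (simp add: centered_gaussian_def)
  have "distr M borel X = distr M borel (\<lambda>_. 0)"
  proof (rule Levy_uniqueness)
    show "char (distr M borel X) = char (distr M borel (\<lambda>_. 0))"
      using X
      by (auto simp: fun_eq_iff centered_gaussian_def char_def integral_distr prob_space simp del: distr_const)
  qed (auto intro!: real_distribution_distr simp del: distr_const)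
  moreover have "AE x in distr M borel (\<lambda>_. 0). x = (0::real)"
    by (subst AE_distr_iff) auto
  ultimately have "AE x in distr M borel X. x = 0"
    by (simp only:)
  then show ?thesis
    by (subst (asm) AE_distr_iff) auto
qed

lemma centered_gaussian_rv:
  assumes "centered_gaussian M v X"
  shows "gaussian_rv M X"
proof (cases "v = 0")
  case True
  then show ?thesis
    using assms centered_gaussian_AE_zero unfolding gaussian_rv_def centered_gaussian_def by blast
next
  case False
  then have "v > 0"
    using assms by (simp add: centered_gaussian_def)
  then show ?thesis
    using centered_gaussian_distributed[OF assms] assms
    unfolding gaussian_rv_def centered_gaussian_def
    by (meson real_sqrt_gt_zero)
qed

text \<open>
  The moments are read off from the density, or from the vanishing of \<open>X\<close> when \<open>v = 0\<close>.  In particular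
  the parameter \<open>v\<close> is determined by \<open>X\<close>, so a variance can be computed by exhibiting a
  characteristic function.
\<close>

lemma centered_gaussian_moments:
  assumes X: "centered_gaussian M v X"
  shows "integrable M X" "expectation X = 0"
    and "integrable M (\<lambda>\<omega>. (X \<omega>)\<^sup>2)" "expectation (\<lambda>\<omega>. (X \<omega>)\<^sup>2) = v"
proof -
  have [measurable]: "X \<in> borel_measurable M"
    using X by (simp add: centered_gaussian_def)
  have "integrable M X \<and> expectation X = 0 \<and> integrable M (\<lambda>\<omega>. (X \<omega>)\<^sup>2) \<and>
      expectation (\<lambda>\<omega>. (X \<omega>)\<^sup>2) = v"
  proof (cases "v = 0")
    case True
    then have *: "AE \<omega> in M. X \<omega> = 0"
      using X centered_gaussian_AE_zero by simp
    then have "AE \<omega> in M. (X \<omega>)\<^sup>2 = 0"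
      by auto
    with * show ?thesis
      by (auto simp: True integral_eq_zero_AE intro!: integrable_cong_AE_imp[OF integrable_zero])
  next
    case False
    then have v: "sqrt v > 0"
      using X by (simp add: centered_gaussian_def)
    then have D: "distributed M lborel X (normal_density 0 (sqrt v))"
      using centered_gaussian_distributed[OF X] by simp
    have int: "integrable M (\<lambda>\<omega>. X \<omega> ^ k)" for k
      using distributed_integrable[OF D, of "\<lambda>x. x ^ k"] integrable_normal_moment[OF v, of 0 k]
      by simp
    have "variance X = v"
      using normal_distributed_variance[OF v D] v by simp
    then show ?thesis
      using int[of 1] int[of 2] normal_distributed_expectation[OF v D] by simp
  qed
  then show "integrable M X" "expectation X = 0"
    "integrable M (\<lambda>\<omega>. (X \<omega>)\<^sup>2)" "expectation (\<lambda>\<omega>. (X \<omega>)\<^sup>2) = v"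
    by auto
qed

lemma nn_expectation_square_centered_gaussian:
  assumes "centered_gaussian M v X"
  shows "(\<integral>\<^sup>+\<omega>. ennreal ((X \<omega>)\<^sup>2) \<partial>M) = ennreal v"
  using centered_gaussian_moments[OF assms] by (simp add: nn_integral_eq_integral)

lemma centered_gaussian_cmult_std_normal:
  assumes D: "distributed M lborel Z std_normal_density"
  shows "centered_gaussian M (a\<^sup>2) (\<lambda>\<omega>. a * Z \<omega>)"
proof -
  have [measurable]: "Z \<in> borel_measurable M"
    using distributed_measurable[OF D] by simp
  have "distr M borel Z = std_normal_distribution"
    using D by (auto simp: distributed_def cong: distr_cong)
  then show ?thesis
    by (simp add: centered_gaussian_def char_distr_cmult char_std_normal_distribution power_mult_distrib)
qed

lemma centered_gaussian_add:
  assumes "indep_var borel X1 borel X2" "centered_gaussian M v1 X1" "centered_gaussian M v2 X2"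
  shows "centered_gaussian M (v1 + v2) (\<lambda>\<omega>. X1 \<omega> + X2 \<omega>)"
proof -
  have "complex_of_real (exp (- (v1 * u\<^sup>2) / 2)) * complex_of_real (exp (- (v2 * u\<^sup>2) / 2))
      = complex_of_real (exp (- ((v1 + v2) * u\<^sup>2) / 2))" for u
    unfolding of_real_mult[symmetric] exp_add[symmetric] by (simp add: field_simps)
  then show ?thesis
    using assms by (auto simp only: centered_gaussian_def char_distr_add borel_measurable_add add_nonneg_nonneg)
qed

lemma centered_gaussian_sum:
  assumes ind: "indep_vars (\<lambda>_. borel) X A" and "finite A"
    and X: "\<And>k. k \<in> A \<Longrightarrow> centered_gaussian M (v k) (X k)"
  shows "centered_gaussian M (\<Sum>k\<in>A. v k) (\<lambda>\<omega>. \<Sum>k\<in>A. X k \<omega>)"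
proof -
  have "(\<Prod>k\<in>A. char (distr M borel (X k)) u) = complex_of_real (exp (- ((\<Sum>k\<in>A. v k) * u\<^sup>2) / 2))" for u
  proof -
    have "(\<Prod>k\<in>A. char (distr M borel (X k)) u) = (\<Prod>k\<in>A. complex_of_real (exp (- (v k * u\<^sup>2) / 2)))"
      using X by (simp add: centered_gaussian_def)
    also have "\<dots> = complex_of_real (exp (\<Sum>k\<in>A. - (v k * u\<^sup>2) / 2))"
      by (simp add: exp_sum \<open>finite A\<close>)
    also have "(\<Sum>k\<in>A. - (v k * u\<^sup>2) / 2) = - ((\<Sum>k\<in>A. v k) * u\<^sup>2) / 2"
      by (simp add: sum_distrib_right sum_negf sum_divide_distrib)
    finally show ?thesis .
  qed
  then show ?thesis
    using X by (auto simp: centered_gaussian_def char_distr_sum[OF ind] intro!: sum_nonneg borel_measurable_sum)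
qed

text \<open>
  Polarization: \<open>4 X Z = (X + Z)^2 - (X - Z)^2\<close>, and the second moments on the right are the variance
  parameters.
\<close>

lemma covariance_polarization:
  assumes X: "centered_gaussian M v X" and Z: "centered_gaussian M v' Z"
    and p: "centered_gaussian M p (\<lambda>\<omega>. X \<omega> + Z \<omega>)"
    and q: "centered_gaussian M q (\<lambda>\<omega>. X \<omega> - Z \<omega>)"
  shows "covariance M X Z = (p - q) / 4"
proof -
  have "covariance M X Z = expectation (\<lambda>\<omega>. ((X \<omega> + Z \<omega>)\<^sup>2 - (X \<omega> - Z \<omega>)\<^sup>2) / 4)"
    using X Z by (simp add: covariance_def centered_gaussian_moments power2_eq_square algebra_simps)
  also have "\<dots> = (p - q) / 4"
    using centered_gaussian_moments(3,4)[OF p] centered_gaussian_moments(3,4)[OF q] by simp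
  finally show ?thesis .
qed

text \<open>
  Since \<open>x \<mapsto> exp (i u x)\<close> is \<open>\<bar>u\<bar>\<close>-Lipschitz, the Cauchy-Schwarz inequality bounds the distance of the
  characteristic functions at \<open>u\<close> by \<open>\<bar>u\<bar>\<close> times the mean-square distance of the variables.  Mean-square
  convergence therefore gives pointwise convergence of characteristic functions.
\<close>

lemma centered_gaussian_mean_square_limit:
  fixes X :: "nat \<Rightarrow> 'a \<Rightarrow> real"
  assumes X: "\<And>n. centered_gaussian M (v n) (X n)" and v: "v \<longlonglongrightarrow> w"
    and [measurable]: "Z \<in> borel_measurable M"
    and lim: "(\<lambda>n. \<integral>\<^sup>+\<omega>. ennreal ((Z \<omega> - X n \<omega>)\<^sup>2) \<partial>M) \<longlonglongrightarrow> 0"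
  shows "centered_gaussian M w Z"
proof -
  have [measurable]: "X n \<in> borel_measurable M" for n
    using X by (simp add: centered_gaussian_def)
  have "char (distr M borel Z) u = complex_of_real (exp (- (w * u\<^sup>2) / 2))" for u
  proof (rule LIMSEQ_unique)
    show "(\<lambda>n. char (distr M borel (X n)) u) \<longlonglongrightarrow> complex_of_real (exp (- (w * u\<^sup>2) / 2))"
      using X unfolding centered_gaussian_def by (simp only:) (intro tendsto_intros v, simp)
    have bnd: "ennreal ((cmod (char (distr M borel (X n)) u - char (distr M borel Z) u))\<^sup>2)
        \<le> ennreal (u\<^sup>2) * (\<integral>\<^sup>+\<omega>. ennreal ((Z \<omega> - X n \<omega>)\<^sup>2) \<partial>M)" (is "ennreal (?N\<^sup>2) \<le> _") for n
    proof -
      have int: "integrable M (\<lambda>\<omega>. iexp (u * X n \<omega>))" "integrable M (\<lambda>\<omega>. iexp (u * Z \<omega>))"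
        by (auto intro!: integrable_iexp)
      have "ennreal ?N = ennreal (cmod (CLINT \<omega>|M. iexp (u * X n \<omega>) - iexp (u * Z \<omega>)))"
        using int by (simp add: char_def integral_distr)
      also have "\<dots> \<le> (\<integral>\<^sup>+\<omega>. ennreal (cmod (iexp (u * X n \<omega>) - iexp (u * Z \<omega>))) \<partial>M)"
        using int by (intro integral_norm_bound_ennreal) auto
      also have "\<dots> \<le> (\<integral>\<^sup>+\<omega>. ennreal \<bar>u\<bar> * ennreal \<bar>Z \<omega> - X n \<omega>\<bar> \<partial>M)"
      proof (intro nn_integral_mono)
        fix \<omega>
        have "cmod (iexp (u * X n \<omega>) - iexp (u * Z \<omega>)) \<le> \<bar>u * X n \<omega> - u * Z \<omega>\<bar>"
          by (rule cmod_iexp_diff_le)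
        also have "\<dots> = \<bar>u\<bar> * \<bar>Z \<omega> - X n \<omega>\<bar>"
          by (simp add: abs_mult abs_minus_commute flip: right_diff_distrib)
        finally show "ennreal (cmod (iexp (u * X n \<omega>) - iexp (u * Z \<omega>))) \<le> ennreal \<bar>u\<bar> * ennreal \<bar>Z \<omega> - X n \<omega>\<bar>"
          by (simp flip: ennreal_mult)
      qed
      finally have "(ennreal ?N)\<^sup>2 \<le> (\<integral>\<^sup>+\<omega>. ennreal \<bar>u\<bar> * ennreal \<bar>Z \<omega> - X n \<omega>\<bar> \<partial>M)\<^sup>2"
        by (rule power_mono) simp
      also have "\<dots> \<le> (\<integral>\<^sup>+\<omega>. (ennreal \<bar>u\<bar>)\<^sup>2 \<partial>M) * (\<integral>\<^sup>+\<omega>. (ennreal \<bar>Z \<omega> - X n \<omega>\<bar>)\<^sup>2 \<partial>M)"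
        by (rule Cauchy_Schwarz_nn_integral) auto
      also have "\<dots> = ennreal (u\<^sup>2) * (\<integral>\<^sup>+\<omega>. ennreal ((Z \<omega> - X n \<omega>)\<^sup>2) \<partial>M)"
        by (simp add: ennreal_power emeasure_space_1)
      finally show ?thesis
        by (simp add: ennreal_power)
    qed
    have ubound: "(\<lambda>n. ennreal (u\<^sup>2) * (\<integral>\<^sup>+\<omega>. ennreal ((Z \<omega> - X n \<omega>)\<^sup>2) \<partial>M)) \<longlonglongrightarrow> 0"
      using tendsto_mult_ennreal[OF tendsto_const[of "ennreal (u\<^sup>2)"] lim] by simp
    have "(\<lambda>n. ennreal ((cmod (char (distr M borel (X n)) u - char (distr M borel Z) u))\<^sup>2)) \<longlonglongrightarrow> 0"
      by (rule tendsto_sandwich[OF _ _ tendsto_const ubound]) (auto intro!: always_eventually bnd)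
    then have "(\<lambda>n. (cmod (char (distr M borel (X n)) u - char (distr M borel Z) u))\<^sup>2) \<longlonglongrightarrow> 0"
      unfolding ennreal_0[symmetric] by (subst (asm) tendsto_ennreal_iff) auto
    then have "(\<lambda>n. cmod (char (distr M borel (X n)) u - char (distr M borel Z) u)) \<longlonglongrightarrow> 0"
      by (drule_tac tendsto_real_sqrt) simp
    then show "(\<lambda>n. char (distr M borel (X n)) u) \<longlonglongrightarrow> char (distr M borel Z) u"
      by (simp only: tendsto_norm_zero_iff LIM_zero_iff)
  qed
  moreover have "0 \<le> w"
    using v X by (intro LIMSEQ_le_const) (auto simp: centered_gaussian_def)
  ultimately show ?thesis
    by (simp add: centered_gaussian_def)
qed

end

section \<open>Mean-square limits\<close>

context prob_space
begin

lemma L1_norm_le_sqrt_mean_square: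
  fixes d :: "'a \<Rightarrow> real"
  assumes d: "integrable M d" and le: "(\<integral>\<^sup>+\<omega>. ennreal ((d \<omega>)\<^sup>2) \<partial>M) \<le> ennreal r" and "0 \<le> r"
  shows "expectation (\<lambda>\<omega>. \<bar>d \<omega>\<bar>) \<le> sqrt r"
proof -
  have [measurable]: "d \<in> borel_measurable M"
    using d by simp
  have "ennreal ((expectation (\<lambda>\<omega>. \<bar>d \<omega>\<bar>))\<^sup>2) = (\<integral>\<^sup>+\<omega>. 1 * ennreal \<bar>d \<omega>\<bar> \<partial>M)\<^sup>2"
    using d by (simp add: nn_integral_eq_integral ennreal_power)
  also have "\<dots> \<le> (\<integral>\<^sup>+\<omega>. 1\<^sup>2 \<partial>M) * (\<integral>\<^sup>+\<omega>. (ennreal \<bar>d \<omega>\<bar>)\<^sup>2 \<partial>M)"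
    by (rule Cauchy_Schwarz_nn_integral) auto
  also have "\<dots> \<le> ennreal r"
    using le by (simp add: ennreal_power emeasure_space_1)
  finally have "(expectation (\<lambda>\<omega>. \<bar>d \<omega>\<bar>))\<^sup>2 \<le> r"
    using \<open>0 \<le> r\<close> by simp
  then show ?thesis
    by (rule real_le_rsqrt)
qed

text \<open>
  Completeness of \<open>L^2\<close> in quantitative form: the limit inherits the Cauchy bound \<open>b\<close>.  A mean-square
  Cauchy sequence is Cauchy in \<open>L^1\<close>, hence has an almost surely convergent subsequence; Fatou's
  lemma along this subsequence bounds the distance of its limit to each \<open>X n\<close>.
\<close>

lemma mean_square_Cauchy_imp_limit:
  fixes X :: "nat \<Rightarrow> 'a \<Rightarrow> real" and b :: "nat \<Rightarrow> real"
  assumes int: "\<And>n. integrable M (X n)"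
    and Cauchy: "\<And>m n. n \<le> m \<Longrightarrow> (\<integral>\<^sup>+\<omega>. ennreal ((X m \<omega> - X n \<omega>)\<^sup>2) \<partial>M) \<le> ennreal (b n)"
    and b: "\<And>n. 0 \<le> b n" "b \<longlonglongrightarrow> 0"
  shows "\<exists>Z \<in> borel_measurable M. \<forall>n. (\<integral>\<^sup>+\<omega>. ennreal ((Z \<omega> - X n \<omega>)\<^sup>2) \<partial>M) \<le> ennreal (b n)"
proof -
  have [measurable]: "X n \<in> borel_measurable M" for n
    using int[of n] by simp
  have L1: "\<exists>N. \<forall>i\<ge>N. \<forall>j\<ge>N. expectation (\<lambda>\<omega>. norm (X i \<omega> - X j \<omega>)) < e" if "e > 0" for e
  proof -
    have "(\<lambda>n. sqrt (b n)) \<longlonglongrightarrow> 0"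
      using tendsto_real_sqrt[OF b(2)] by simp
    then obtain N where N: "\<And>n. n \<ge> N \<Longrightarrow> sqrt (b n) < e"
      using order_tendstoD(2)[of _ 0 sequentially e] \<open>e > 0\<close> by (auto simp: eventually_sequentially)
    have *: "expectation (\<lambda>\<omega>. norm (X i \<omega> - X j \<omega>)) < e" if "N \<le> j" "j \<le> i" for i j
    proof -
      have "expectation (\<lambda>\<omega>. \<bar>X i \<omega> - X j \<omega>\<bar>) \<le> sqrt (b j)"
        using int Cauchy[OF that(2)] b(1) by (intro L1_norm_le_sqrt_mean_square) auto
      with N[OF that(1)] show ?thesis
        by simp
    qed
    show ?thesis
    proof (intro exI[of _ N] allI impI)
      fix i j assume "N \<le> i" "N \<le> j"
      then show "expectation (\<lambda>\<omega>. norm (X i \<omega> - X j \<omega>)) < e"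
        using *[of i j] *[of j i]
        by (cases "i \<le> j") (auto simp: abs_minus_commute[of "X j _" "X i _"])
    qed
  qed
  obtain r where r: "strict_mono r" and AE_C: "AE \<omega> in M. Cauchy (\<lambda>i. X (r i) \<omega>)"
    using cauchy_L1_AE_cauchy_subseq[OF int L1] by blast
  define Z where "Z \<omega> = lim (\<lambda>i. X (r i) \<omega>)" for \<omega>
  have [measurable]: "Z \<in> borel_measurable M"
    unfolding Z_def by simp
  have "(\<integral>\<^sup>+\<omega>. ennreal ((Z \<omega> - X n \<omega>)\<^sup>2) \<partial>M) \<le> ennreal (b n)" for n
  proof -
    have "(\<integral>\<^sup>+\<omega>. ennreal ((Z \<omega> - X n \<omega>)\<^sup>2) \<partial>M)
        = (\<integral>\<^sup>+\<omega>. liminf (\<lambda>i. ennreal ((X (r i) \<omega> - X n \<omega>)\<^sup>2)) \<partial>M)"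
    proof (rule nn_integral_cong_AE, use AE_C in eventually_elim)
      fix \<omega> assume "Cauchy (\<lambda>i. X (r i) \<omega>)"
      then have "(\<lambda>i. X (r i) \<omega>) \<longlonglongrightarrow> Z \<omega>"
        by (simp add: Z_def Cauchy_convergent_iff convergent_LIMSEQ_iff)
      then have "(\<lambda>i. ennreal ((X (r i) \<omega> - X n \<omega>)\<^sup>2)) \<longlonglongrightarrow> ennreal ((Z \<omega> - X n \<omega>)\<^sup>2)"
        by (intro tendsto_intros)
      then show "ennreal ((Z \<omega> - X n \<omega>)\<^sup>2) = liminf (\<lambda>i. ennreal ((X (r i) \<omega> - X n \<omega>)\<^sup>2))"
        by (intro lim_imp_Liminf[symmetric] trivial_limit_sequentially)
    qed
    also have "\<dots> \<le> liminf (\<lambda>i. \<integral>\<^sup>+\<omega>. ennreal ((X (r i) \<omega> - X n \<omega>)\<^sup>2) \<partial>M)"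
      by (rule nn_integral_liminf) simp
    also have "\<dots> \<le> liminf (\<lambda>_. ennreal (b n))"
    proof (rule Liminf_mono, rule eventually_sequentiallyI)
      fix i assume "n \<le> i"
      then show "(\<integral>\<^sup>+\<omega>. ennreal ((X (r i) \<omega> - X n \<omega>)\<^sup>2) \<partial>M) \<le> ennreal (b n)"
        using seq_suble[OF r, of i] by (intro Cauchy) simp
    qed
    also have "\<dots> = ennreal (b n)"
      by (simp add: Liminf_const)
    finally show ?thesis .
  qed
  then show ?thesis
    by (intro bexI[of _ Z]) auto
qed

end

text \<open>
  By the Cauchy-Schwarz inequality for sums, the error of the combination is at most
  \<open>\<Sum>i\<in>T. (w i)^2\<close> times the sum of the individual mean-square errors.
\<close>

lemma mean_square_limit_lincomb:
  fixes X :: "nat \<Rightarrow> 'i \<Rightarrow> 'a \<Rightarrow> real" and Z :: "'i \<Rightarrow> 'a \<Rightarrow> real"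
  assumes "finite T"
    and [measurable]: "\<And>i. i \<in> T \<Longrightarrow> Z i \<in> borel_measurable M"
      "\<And>n i. i \<in> T \<Longrightarrow> X n i \<in> borel_measurable M"
    and lim: "\<And>i. i \<in> T \<Longrightarrow> (\<lambda>n. \<integral>\<^sup>+\<omega>. ennreal ((Z i \<omega> - X n i \<omega>)\<^sup>2) \<partial>M) \<longlonglongrightarrow> 0"
  shows "(\<lambda>n. \<integral>\<^sup>+\<omega>. ennreal (((\<Sum>i\<in>T. w i * Z i \<omega>) - (\<Sum>i\<in>T. w i * X n i \<omega>))\<^sup>2) \<partial>M) \<longlonglongrightarrow> 0"
proof -
  define W where "W = (\<Sum>i\<in>T. (w i)\<^sup>2)"
  have bnd: "(\<integral>\<^sup>+\<omega>. ennreal (((\<Sum>i\<in>T. w i * Z i \<omega>) - (\<Sum>i\<in>T. w i * X n i \<omega>))\<^sup>2) \<partial>M)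
      \<le> ennreal W * (\<Sum>i\<in>T. \<integral>\<^sup>+\<omega>. ennreal ((Z i \<omega> - X n i \<omega>)\<^sup>2) \<partial>M)" for n
  proof -
    have "ennreal (((\<Sum>i\<in>T. w i * Z i \<omega>) - (\<Sum>i\<in>T. w i * X n i \<omega>))\<^sup>2)
        \<le> ennreal W * (\<Sum>i\<in>T. ennreal ((Z i \<omega> - X n i \<omega>)\<^sup>2))" for \<omega>
    proof -
      have "((\<Sum>i\<in>T. w i * Z i \<omega>) - (\<Sum>i\<in>T. w i * X n i \<omega>))\<^sup>2 = (\<Sum>i\<in>T. w i * (Z i \<omega> - X n i \<omega>))\<^sup>2"
        by (simp add: right_diff_distrib sum_subtractf)
      also have "\<dots> \<le> W * (\<Sum>i\<in>T. (Z i \<omega> - X n i \<omega>)\<^sup>2)"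
        unfolding W_def by (rule Cauchy_Schwarz_ineq_sum)
      finally show ?thesis
        by (simp add: W_def sum_nonneg flip: ennreal_mult)
    qed
    then have "(\<integral>\<^sup>+\<omega>. ennreal (((\<Sum>i\<in>T. w i * Z i \<omega>) - (\<Sum>i\<in>T. w i * X n i \<omega>))\<^sup>2) \<partial>M)
        \<le> (\<integral>\<^sup>+\<omega>. ennreal W * (\<Sum>i\<in>T. ennreal ((Z i \<omega> - X n i \<omega>)\<^sup>2)) \<partial>M)"
      by (intro nn_integral_mono)
    also have "\<dots> = ennreal W * (\<Sum>i\<in>T. \<integral>\<^sup>+\<omega>. ennreal ((Z i \<omega> - X n i \<omega>)\<^sup>2) \<partial>M)"
      by (subst nn_integral_cmult) (simp_all add: nn_integral_sum del: sum_ennreal)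
    finally show ?thesis .
  qed
  have "(\<lambda>n. \<Sum>i\<in>T. \<integral>\<^sup>+\<omega>. ennreal ((Z i \<omega> - X n i \<omega>)\<^sup>2) \<partial>M) \<longlonglongrightarrow> (\<Sum>i\<in>T. 0)"
    by (intro tendsto_sum lim)
  then have "(\<lambda>n. ennreal W * (\<Sum>i\<in>T. \<integral>\<^sup>+\<omega>. ennreal ((Z i \<omega> - X n i \<omega>)\<^sup>2) \<partial>M)) \<longlonglongrightarrow> ennreal W * (\<Sum>i\<in>T. 0)"
    by (intro tendsto_mult_ennreal tendsto_const) auto
  then have ubound: "(\<lambda>n. ennreal W * (\<Sum>i\<in>T. \<integral>\<^sup>+\<omega>. ennreal ((Z i \<omega> - X n i \<omega>)\<^sup>2) \<partial>M)) \<longlonglongrightarrow> 0"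
    by simp
  show ?thesis
    by (rule tendsto_sandwich[OF _ _ tendsto_const ubound]) (auto intro!: always_eventually bnd)
qed

section \<open>The trigonometric process and its limit\<close>

text \<open>
  Up to sign, the standard deviation of the component of frequency \<open>k\<close>.  Absorbing the factor \<open>sqrt 2\<close>, which is
  absent at frequency \<open>0\<close>, lets a single sum over \<open>k \<le> n\<close> represent the process.
\<close>

definition amplitude :: "(nat \<Rightarrow> real) \<Rightarrow> nat \<Rightarrow> real" where
  "amplitude c k = (if k = 0 then c 0 else sqrt 2 * c k)"

definition variance_tail :: "(nat \<Rightarrow> real) \<Rightarrow> nat \<Rightarrow> real" where
  "variance_tail c n = (\<Sum>k. (amplitude c k)\<^sup>2) - (\<Sum>k\<le>n. (amplitude c k)\<^sup>2)"

text \<open>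
  This is the squared modulus of \<open>\<Sum>i\<in>T. w i * exp (\<i> * 2 k pi \<tau> i)\<close>: the variance that frequency \<open>k\<close>
  contributes, at unit amplitude, to the combination of the process values at the times \<open>\<tau> i\<close> with
  weights \<open>w i\<close>.  The times are indexed by an arbitrary set rather than
  being the elements of \<open>T\<close> themselves, so that a time may occur twice; this is needed for the
  covariance at \<open>s = t\<close>.
\<close>

definition frequency_form :: "'i set \<Rightarrow> ('i \<Rightarrow> real) \<Rightarrow> ('i \<Rightarrow> real) \<Rightarrow> nat \<Rightarrow> real" where
  "frequency_form T w \<tau> k =
     (\<Sum>i\<in>T. w i * sin (2 * real k * pi * \<tau> i))\<^sup>2 + (\<Sum>i\<in>T. w i * cos (2 * real k * pi * \<tau> i))\<^sup>2"

lemma summable_amplitude_square: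
  assumes "summable (\<lambda>k. (c k)\<^sup>2)"
  shows "summable (\<lambda>k. (amplitude c k)\<^sup>2)"
proof (rule summable_comparison_test'[OF summable_mult[OF assms, of 2]])
  show "norm ((amplitude c k)\<^sup>2) \<le> 2 * (c k)\<^sup>2" for k
    by (simp add: amplitude_def power_mult_distrib)
qed

lemma variance_tail_nonneg:
  assumes "summable (\<lambda>k. (c k)\<^sup>2)"
  shows "0 \<le> variance_tail c n"
  using sum_le_suminf[OF summable_amplitude_square[OF assms], of "{..n}"] by (simp add: variance_tail_def)

lemma tendsto_variance_tail:
  assumes "summable (\<lambda>k. (c k)\<^sup>2)"
  shows "variance_tail c \<longlonglongrightarrow> 0"
  using tendsto_diff[OF tendsto_const summable_LIMSEQ'[OF summable_amplitude_square[OF assms]],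
      of "\<Sum>k. (amplitude c k)\<^sup>2"]
  by (simp add: variance_tail_def[abs_def])

lemma sum_atMost_split:
  fixes f :: "nat \<Rightarrow> 'b::comm_monoid_add"
  assumes "n \<le> m"
  shows "(\<Sum>k\<le>m. f k) = (\<Sum>k\<le>n. f k) + (\<Sum>k\<in>{n<..m}. f k)"
  using sum.union_disjoint[of "{..n}" "{n<..m}" f] ivl_disj_un_one(3)[OF assms]
  by (auto simp: disjoint_iff)

lemma sum_amplitude_le_variance_tail:
  assumes "summable (\<lambda>k. (c k)\<^sup>2)" and "n \<le> m"
  shows "(\<Sum>k\<in>{n<..m}. (amplitude c k)\<^sup>2) \<le> variance_tail c n"
  using variance_tail_nonneg[OF assms(1), of m] sum_atMost_split[OF assms(2), of "\<lambda>k. (amplitude c k)\<^sup>2"]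
  by (simp add: variance_tail_def)

text \<open>
  The bound does not depend on \<open>k\<close>, so multiplying a summable series by the form keeps it summable.
\<close>

lemma frequency_form_le: "frequency_form T w \<tau> k \<le> 2 * (\<Sum>i\<in>T. \<bar>w i\<bar>)\<^sup>2"
proof -
  have "\<bar>\<Sum>i\<in>T. w i * g i\<bar> \<le> (\<Sum>i\<in>T. \<bar>w i\<bar>)" if "\<And>i. \<bar>g i\<bar> \<le> 1" for g
  proof -
    have "\<bar>\<Sum>i\<in>T. w i * g i\<bar> \<le> (\<Sum>i\<in>T. \<bar>w i * g i\<bar>)"
      by (rule sum_abs)
    also have "\<dots> \<le> (\<Sum>i\<in>T. \<bar>w i\<bar>)"
      using that by (intro sum_mono) (simp add: abs_mult mult_left_le)
    finally show ?thesis .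
  qed
  from this[of "\<lambda>i. sin (2 * real k * pi * \<tau> i)"] this[of "\<lambda>i. cos (2 * real k * pi * \<tau> i)"]
  have "(\<Sum>i\<in>T. w i * sin (2 * real k * pi * \<tau> i))\<^sup>2 \<le> (\<Sum>i\<in>T. \<bar>w i\<bar>)\<^sup>2"
    "(\<Sum>i\<in>T. w i * cos (2 * real k * pi * \<tau> i))\<^sup>2 \<le> (\<Sum>i\<in>T. \<bar>w i\<bar>)\<^sup>2"
    by (auto intro!: power2_le_iff_abs_le[THEN iffD2] sum_nonneg)
  then show ?thesis
    by (simp add: frequency_form_def)
qed

lemma summable_frequency_form:
  assumes "summable (\<lambda>k. (c k)\<^sup>2)"
  shows "summable (\<lambda>k. (amplitude c k)\<^sup>2 * frequency_form T w \<tau> k)"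
proof (rule summable_comparison_test'[OF summable_mult2[OF summable_amplitude_square[OF assms]]])
  show "norm ((amplitude c k)\<^sup>2 * frequency_form T w \<tau> k)
      \<le> (amplitude c k)\<^sup>2 * (2 * (\<Sum>i\<in>T. \<bar>w i\<bar>)\<^sup>2)" for k
    using frequency_form_le[of T w \<tau> k]
    by (simp add: abs_mult frequency_form_def mult_left_mono)
qed

text \<open>
  The forms of the sum and of the difference of the values at times \<open>s\<close> and \<open>t\<close>, indexed by the
  Booleans, differ by four times
  \<open>sin (2 k pi s) * sin (2 k pi t) + cos (2 k pi s) * cos (2 k pi t)\<close>.
\<close>

lemma frequency_form_polarization:
  "frequency_form UNIV (\<lambda>_. 1) (case_bool s t) k - frequency_form UNIV (case_bool 1 (- 1)) (case_bool s t) k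
    = 4 * cos (2 * real k * pi * (s - t))"
proof -
  have polarize: "(x + x')\<^sup>2 + (z + z')\<^sup>2 - ((x - x')\<^sup>2 + (z - z')\<^sup>2) = 4 * (z * z' + x * x')"
    for x x' z z' :: real
    by (simp add: power2_eq_square algebra_simps)
  show ?thesis
    using polarize[of "sin (2 * real k * pi * s)" "sin (2 * real k * pi * t)"
        "cos (2 * real k * pi * s)" "cos (2 * real k * pi * t)"]
    by (simp only: frequency_form_def UNIV_bool right_diff_distrib cos_diff) (simp add: ac_simps)
qed

text \<open>
  The added sine term at frequency \<open>0\<close> vanishes, whatever \<open>Y 0\<close> is, and the cosine term there is
  \<open>c 0 * Y' 0\<close>.
\<close>

lemma trig_process_eq:
  "trig_process c Y Y' n t \<omega> =
     (\<Sum>k\<le>n. amplitude c k * sin (2 * real k * pi * t) * Y k \<omega>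
           + amplitude c k * cos (2 * real k * pi * t) * Y' k \<omega>)"
proof -
  have "{..n} = insert 0 {1..n}"
    by auto
  then show ?thesis
    by (auto simp: trig_process_def amplitude_def algebra_simps intro!: sum.cong)
qed

lemma trig_process_lincomb_eq:
  "(\<Sum>i\<in>T. w i * trig_process c Y Y' n (\<tau> i) \<omega>) =
     (\<Sum>k\<le>n. amplitude c k * (\<Sum>i\<in>T. w i * sin (2 * real k * pi * \<tau> i)) * Y k \<omega>
           + amplitude c k * (\<Sum>i\<in>T. w i * cos (2 * real k * pi * \<tau> i)) * Y' k \<omega>)"
proof -
  have "(\<Sum>i\<in>T. w i * trig_process c Y Y' n (\<tau> i) \<omega>) =
     (\<Sum>k\<le>n. \<Sum>i\<in>T. w i * (amplitude c k * sin (2 * real k * pi * \<tau> i) * Y k \<omega>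
           + amplitude c k * cos (2 * real k * pi * \<tau> i) * Y' k \<omega>))"
    unfolding trig_process_eq sum_distrib_left by (rule sum.swap)
  then show ?thesis
    by (simp add: sum_distrib_left sum_distrib_right sum.distrib algebra_simps)
qed

lemma trig_process_0_eq_1: "trig_process c Y Y' n 0 = trig_process c Y Y' n 1"
  by (simp add: trig_process_def fun_eq_iff sin_times_pi_eq_0 cos_int_2pin)

locale independent_std_normals = prob_space M for M :: "'a measure" +
  fixes Y Y' :: "nat \<Rightarrow> 'a \<Rightarrow> real"
  assumes Y_normal: "\<And>n. n \<ge> 1 \<Longrightarrow> distributed M lborel (Y n) std_normal_density"
    and Y'_normal: "\<And>n. distributed M lborel (Y' n) std_normal_density"
    and Y_indep: "indep_vars (\<lambda>_. borel) Y {1..}"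
    and Y'_indep: "indep_vars (\<lambda>_. borel) Y' UNIV"
    and Y_Y'_indep: "indep_var
           (PiM {1..} (\<lambda>_. borel)) (\<lambda>\<omega>. \<lambda>n\<in>{1..}. Y n \<omega>)
           (PiM UNIV (\<lambda>_. borel)) (\<lambda>\<omega> n. Y' n \<omega>)"
begin

text \<open>
  Within each of the two sequences the summands are independent, and the two partial sums are
  independent of each other because each is a measurable function of its own sequence.  The
  condition \<open>a 0 = 0\<close> removes \<open>Y 0\<close>.
\<close>

lemma centered_gaussian_coefficient_sum:
  assumes K: "finite K" and "a 0 = 0"
  shows "centered_gaussian M (\<Sum>k\<in>K. (a k)\<^sup>2 + (b k)\<^sup>2) (\<lambda>\<omega>. \<Sum>k\<in>K. a k * Y k \<omega> + b k * Y' k \<omega>)"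
proof -
  let ?A = "K - {0}"
  have A: "finite ?A" "?A \<subseteq> {1..}"
    using K by auto
  have "centered_gaussian M (\<Sum>k\<in>?A. (a k)\<^sup>2) (\<lambda>\<omega>. \<Sum>k\<in>?A. a k * Y k \<omega>)"
    using A by (intro centered_gaussian_sum centered_gaussian_cmult_std_normal Y_normal
        indep_vars_compose2[OF indep_vars_subset[OF Y_indep]]) auto
  moreover have "centered_gaussian M (\<Sum>k\<in>K. (b k)\<^sup>2) (\<lambda>\<omega>. \<Sum>k\<in>K. b k * Y' k \<omega>)"
    using K by (intro centered_gaussian_sum centered_gaussian_cmult_std_normal Y'_normal
        indep_vars_compose2[OF indep_vars_subset[OF Y'_indep]]) auto
  moreover have "indep_var borel (\<lambda>\<omega>. \<Sum>k\<in>?A. a k * Y k \<omega>) borel (\<lambda>\<omega>. \<Sum>k\<in>K. b k * Y' k \<omega>)"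
  proof -
    have "indep_var borel ((\<lambda>f. \<Sum>k\<in>?A. a k * f k) \<circ> (\<lambda>\<omega>. \<lambda>n\<in>{1..}. Y n \<omega>))
        borel ((\<lambda>f. \<Sum>k\<in>K. b k * f k) \<circ> (\<lambda>\<omega> n. Y' n \<omega>))"
      using A by (intro indep_var_compose[OF Y_Y'_indep] borel_measurable_sum borel_measurable_times
          borel_measurable_const measurable_component_singleton) auto
    moreover have "(\<lambda>f. \<Sum>k\<in>?A. a k * f k) \<circ> (\<lambda>\<omega>. \<lambda>n\<in>{1..}. Y n \<omega>) = (\<lambda>\<omega>. \<Sum>k\<in>?A. a k * Y k \<omega>)"
      by (auto intro!: sum.cong)
    ultimately show ?thesis
      by (simp add: comp_def)
  qed
  ultimately have "centered_gaussian M ((\<Sum>k\<in>?A. (a k)\<^sup>2) + (\<Sum>k\<in>K. (b k)\<^sup>2))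
      (\<lambda>\<omega>. (\<Sum>k\<in>?A. a k * Y k \<omega>) + (\<Sum>k\<in>K. b k * Y' k \<omega>))"
    by (intro centered_gaussian_add)
  moreover have "(\<Sum>k\<in>?A. (a k)\<^sup>2) = (\<Sum>k\<in>K. (a k)\<^sup>2)" "(\<Sum>k\<in>?A. a k * Y k \<omega>) = (\<Sum>k\<in>K. a k * Y k \<omega>)" for \<omega>
    using K \<open>a 0 = 0\<close> by (auto intro!: sum.mono_neutral_left)
  ultimately show ?thesis
    by (simp add: sum.distrib)
qed

lemma centered_gaussian_trig_process_lincomb:
  "centered_gaussian M (\<Sum>k\<le>n. (amplitude c k)\<^sup>2 * frequency_form T w \<tau> k)
     (\<lambda>\<omega>. \<Sum>i\<in>T. w i * trig_process c Y Y' n (\<tau> i) \<omega>)"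
  unfolding trig_process_lincomb_eq
  using centered_gaussian_coefficient_sum[of "{..n}"
      "\<lambda>k. amplitude c k * (\<Sum>i\<in>T. w i * sin (2 * real k * pi * \<tau> i))"
      "\<lambda>k. amplitude c k * (\<Sum>i\<in>T. w i * cos (2 * real k * pi * \<tau> i))"]
  by (simp add: frequency_form_def power_mult_distrib distrib_left)

lemma centered_gaussian_trig_process:
  "\<exists>v. centered_gaussian M v (trig_process c Y Y' n t)"
  using centered_gaussian_trig_process_lincomb[where T = "{()}" and w = "\<lambda>_. 1" and \<tau> = "\<lambda>_. t"] by auto

text \<open>
  The frequencies in \<open>{n<..m}\<close> contribute \<open>(amplitude c k)^2 * (sin^2 + cos^2)\<close> to the variance, so the
  bound is the same for every \<open>t\<close>.
\<close>

lemma mean_square_trig_process_diff_le: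
  assumes "summable (\<lambda>k. (c k)\<^sup>2)" and "n \<le> m"
  shows "(\<integral>\<^sup>+\<omega>. ennreal ((trig_process c Y Y' m t \<omega> - trig_process c Y Y' n t \<omega>)\<^sup>2) \<partial>M)
     \<le> ennreal (variance_tail c n)"
proof -
  let ?a = "\<lambda>k. amplitude c k * sin (2 * real k * pi * t)"
  let ?b = "\<lambda>k. amplitude c k * cos (2 * real k * pi * t)"
  have *: "trig_process c Y Y' m t \<omega> - trig_process c Y Y' n t \<omega>
      = (\<Sum>k\<in>{n<..m}. ?a k * Y k \<omega> + ?b k * Y' k \<omega>)" for \<omega>
    by (simp add: trig_process_eq sum_atMost_split[OF \<open>n \<le> m\<close>])
  have "(\<Sum>k\<in>{n<..m}. (?a k)\<^sup>2 + (?b k)\<^sup>2) = (\<Sum>k\<in>{n<..m}. (amplitude c k)\<^sup>2)"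
    by (simp add: power_mult_distrib flip: distrib_left)
  then have "centered_gaussian M (\<Sum>k\<in>{n<..m}. (amplitude c k)\<^sup>2)
      (\<lambda>\<omega>. \<Sum>k\<in>{n<..m}. ?a k * Y k \<omega> + ?b k * Y' k \<omega>)"
    using centered_gaussian_coefficient_sum[of "{n<..m}" ?a ?b] by simp
  from nn_expectation_square_centered_gaussian[OF this] show ?thesis
    using sum_amplitude_le_variance_tail[OF assms] by (simp add: * ennreal_leI)
qed

text \<open>
  The limit is chosen as a function of the sequence of partial sums and not of the time.  The partial
  sums at \<open>0\<close> and at \<open>1\<close> form the same sequence, so \<open>y 0 = y 1\<close> holds everywhere and not just
  almost surely.
\<close>

lemma trig_process_mean_square_limit:
  assumes c: "summable (\<lambda>k. (c k)\<^sup>2)"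
  obtains y where "\<And>t. y t \<in> borel_measurable M" and "y 0 = y 1"
    and "\<And>t n. (\<integral>\<^sup>+\<omega>. ennreal ((y t \<omega> - trig_process c Y Y' n t \<omega>)\<^sup>2) \<partial>M) \<le> ennreal (variance_tail c n)"
proof -
  (* y t is chosen through P, whose first argument is the whole sequence of partial sums. *)
  define P where "P X Z \<longleftrightarrow> Z \<in> borel_measurable M \<and>
     (\<forall>n. (\<integral>\<^sup>+\<omega>. ennreal ((Z \<omega> - X n \<omega>)\<^sup>2) \<partial>M) \<le> ennreal (variance_tail c n))"
    for X :: "nat \<Rightarrow> 'a \<Rightarrow> real" and Z :: "'a \<Rightarrow> real"
  define y where "y t = (SOME Z. P (\<lambda>n. trig_process c Y Y' n t) Z)" for t
  have "\<exists>Z. P (\<lambda>n. trig_process c Y Y' n t) Z" for t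
  proof -
    have "integrable M (trig_process c Y Y' n t)" for n
      using centered_gaussian_trig_process centered_gaussian_moments(1) by blast
    then show ?thesis
      using mean_square_Cauchy_imp_limit[of "\<lambda>n. trig_process c Y Y' n t" "variance_tail c"]
        mean_square_trig_process_diff_le[OF c] variance_tail_nonneg[OF c] tendsto_variance_tail[OF c]
      unfolding P_def by blast
  qed
  then have "P (\<lambda>n. trig_process c Y Y' n t) (y t)" for t
    unfolding y_def by (rule someI_ex)
  moreover have "y 0 = y 1"
    by (simp add: y_def trig_process_0_eq_1)
  ultimately show thesis
    using that unfolding P_def by blast
qed

text \<open>
  The variances of the combinations of partial sums are the partial sums of a convergent series, so
  the closure of centred Gaussian laws under mean-square limits applies.
\<close>

lemma centered_gaussian_limit_lincomb:
  assumes c: "summable (\<lambda>k. (c k)\<^sup>2)" and "finite T"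
    and y: "\<And>t. y t \<in> borel_measurable M"
    and lim: "\<And>t. (\<lambda>n. \<integral>\<^sup>+\<omega>. ennreal ((y t \<omega> - trig_process c Y Y' n t \<omega>)\<^sup>2) \<partial>M) \<longlonglongrightarrow> 0"
  shows "centered_gaussian M (\<Sum>k. (amplitude c k)\<^sup>2 * frequency_form T w \<tau> k)
     (\<lambda>\<omega>. \<Sum>i\<in>T. w i * y (\<tau> i) \<omega>)"
proof (rule centered_gaussian_mean_square_limit)
  show "(\<lambda>n. \<Sum>k\<le>n. (amplitude c k)\<^sup>2 * frequency_form T w \<tau> k)
      \<longlonglongrightarrow> (\<Sum>k. (amplitude c k)\<^sup>2 * frequency_form T w \<tau> k)"
    by (rule summable_LIMSEQ'[OF summable_frequency_form[OF c]])
  have "trig_process c Y Y' n t \<in> borel_measurable M" for n t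
    using centered_gaussian_trig_process unfolding centered_gaussian_def by blast
  then show "(\<lambda>n. \<integral>\<^sup>+\<omega>. ennreal (((\<Sum>i\<in>T. w i * y (\<tau> i) \<omega>)
      - (\<Sum>i\<in>T. w i * trig_process c Y Y' n (\<tau> i) \<omega>))\<^sup>2) \<partial>M) \<longlonglongrightarrow> 0"
    using y lim \<open>finite T\<close> by (intro mean_square_limit_lincomb)
qed (use y in \<open>auto intro!: centered_gaussian_trig_process_lincomb\<close>)

text \<open>
  The variances of \<open>y s + y t\<close> and \<open>y s - y t\<close> are known as series, so polarization gives the covariance
  directly, without computing any expectation of a product \<open>Y j * Y k\<close>.
\<close>

lemma covariance_fun_limit:
  assumes c: "summable (\<lambda>k. (c k)\<^sup>2)"
    and y: "\<And>t. y t \<in> borel_measurable M"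
    and lim: "\<And>t. (\<lambda>n. \<integral>\<^sup>+\<omega>. ennreal ((y t \<omega> - trig_process c Y Y' n t \<omega>)\<^sup>2) \<partial>M) \<longlonglongrightarrow> 0"
  shows "covariance_fun M y s t = (\<Sum>k. (amplitude c k)\<^sup>2 * cos (2 * real k * pi * (s - t)))"
proof -
  (* The index type bool allows s = t; the singleton {()} yields y s and y t themselves. *)
  note gauss = centered_gaussian_limit_lincomb[where y = y, OF c _ y lim]
  let ?\<tau> = "case_bool s t"
  let ?p = "frequency_form UNIV (\<lambda>_. 1) ?\<tau>" and ?q = "frequency_form UNIV (case_bool 1 (- 1)) ?\<tau>"
  have "covariance M (y s) (y t)
      = ((\<Sum>k. (amplitude c k)\<^sup>2 * ?p k) - (\<Sum>k. (amplitude c k)\<^sup>2 * ?q k)) / 4"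
    using gauss[of "{()}" "\<lambda>_. 1" "\<lambda>_. s"] gauss[of "{()}" "\<lambda>_. 1" "\<lambda>_. t"]
      gauss[of UNIV "\<lambda>_. 1" ?\<tau>] gauss[of UNIV "case_bool 1 (- 1)" ?\<tau>]
    by (intro covariance_polarization) (auto simp: UNIV_bool add.commute)
  also have "\<dots> = (\<Sum>k. ((amplitude c k)\<^sup>2 * ?p k - (amplitude c k)\<^sup>2 * ?q k) / 4)"
    unfolding suminf_diff[OF summable_frequency_form[OF c] summable_frequency_form[OF c]]
    by (rule suminf_divide[symmetric]) (intro summable_diff summable_frequency_form c)
  also have "\<dots> = (\<Sum>k. (amplitude c k)\<^sup>2 * ((?p k - ?q k) / 4))"
    by (simp only: right_diff_distrib diff_divide_distrib times_divide_eq_right)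
  also have "\<dots> = (\<Sum>k. (amplitude c k)\<^sup>2 * cos (2 * real k * pi * (s - t)))"
    by (simp add: frequency_form_polarization)
  finally show ?thesis
    by (simp add: covariance_fun_def)
qed

end

section \<open>The covariance series\<close>

text \<open>
  Splitting off \<open>k = 0\<close>, where the cosine is \<open>1\<close>, relates the series in \<open>amplitude\<close> to the one
  in \<open>c\<close>, where the factor \<open>2\<close> starts at \<open>k = 1\<close>.
\<close>

lemma covariance_partial_sum_eq:
  "(c 0)\<^sup>2 + (\<Sum>k=1..n. 2 * (c k)\<^sup>2 * cos (2 * real k * pi * d))
    = (\<Sum>k\<le>n. (amplitude c k)\<^sup>2 * cos (2 * real k * pi * d))"
proof -
  have "{..n} = insert 0 {1..n}"
    by auto
  then show ?thesis
    by (auto simp: amplitude_def power_mult_distrib intro!: sum.cong)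
qed

lemma summable_covariance_series:
  assumes "summable (\<lambda>k. (c k)\<^sup>2)"
  shows "summable (\<lambda>k. \<bar>(amplitude c k)\<^sup>2 * cos (2 * real k * pi * d)\<bar>)"
  by (rule summable_comparison_test'[OF summable_amplitude_square[OF assms]])
     (simp add: abs_mult mult_left_le)

lemma covariance_series_eq:
  assumes "summable (\<lambda>k. (c k)\<^sup>2)"
  shows "(\<Sum>k. (amplitude c k)\<^sup>2 * cos (2 * real k * pi * d))
    = (c 0)\<^sup>2 + (\<Sum>k. 2 * (c (Suc k))\<^sup>2 * cos (2 * real (Suc k) * pi * d))"
  using suminf_split_head[OF summable_rabs_cancel[OF summable_covariance_series[OF assms]], of d]
  by (simp add: amplitude_def power_mult_distrib)

lemma uniform_limit_covariance_series:
  assumes "summable (\<lambda>k. (c k)\<^sup>2)"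
  shows "uniform_limit UNIV
     (\<lambda>n d. \<Sum>k\<le>n. (amplitude c k)\<^sup>2 * cos (2 * real k * pi * d))
     (\<lambda>d. \<Sum>k. (amplitude c k)\<^sup>2 * cos (2 * real k * pi * d)) sequentially"
proof -
  have "uniform_limit UNIV
     (\<lambda>n d. \<Sum>k<n. (amplitude c k)\<^sup>2 * cos (2 * real k * pi * d))
     (\<lambda>d. \<Sum>k. (amplitude c k)\<^sup>2 * cos (2 * real k * pi * d)) sequentially"
    by (rule Weierstrass_m_test[OF _ summable_amplitude_square[OF assms]])
       (simp add: abs_mult mult_left_le)
  from filterlim_compose[OF this filterlim_Suc] show ?thesis
    by (simp add: lessThan_Suc_atMost)
qed

text \<open>
  A compact set has finite Lebesgue measure \<open>m\<close>, so a uniform error \<open>\<delta>\<close> gives an integrated squared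
  error of at most \<open>\<delta>^2 * m\<close>; continuity on the compact set provides the square integrability.
\<close>

lemma L2_limit_on_compact_if_uniform_limit:
  fixes f :: "'b::euclidean_space \<Rightarrow> real"
  assumes K: "compact K" and cont: "\<And>n. continuous_on K (fn n)"
    and unif: "uniform_limit K fn f sequentially"
  shows "L2_limit_on lborel K fn f"
proof -
  have sq: "square_integrable_on lborel K g" if "continuous_on K g" for g :: "'b \<Rightarrow> real"
    using borel_integrable_compact[OF K that] borel_integrable_compact[OF K continuous_on_power[OF that, of 2]]
    by (auto simp: square_integrable_on_def set_borel_measurable_def set_integrable_def)
  have "continuous_on K f"
    by (rule uniform_limit_theorem[OF _ unif]) (auto simp: cont)
  moreover have "(\<lambda>n. \<integral>\<^sup>+x\<in>K. ennreal ((f x - fn n x)\<^sup>2) \<partial>lborel) \<longlonglongrightarrow> 0"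
  proof (rule tendsto_zero_ennreal)
    fix r :: real assume "0 < r"
    define m where "m = measure lborel K"
    have K': "K \<in> sets lborel" "emeasure lborel K = ennreal m"
      using K emeasure_compact_finite[OF K]
      by (auto simp: m_def emeasure_eq_ennreal_measure borel_compact)
    have m: "0 \<le> m"
      by (simp add: m_def)
    (* With m + 1 in place of m the quotient is defined when K is a null set. *)
    define \<delta> where "\<delta> = sqrt (r / (m + 1))"
    have "\<delta> > 0"
      using \<open>0 < r\<close> m by (simp add: \<delta>_def)
    have "\<delta>\<^sup>2 * m < r"
      using \<open>0 < r\<close> m by (simp add: \<delta>_def field_simps)
    show "\<forall>\<^sub>F n in sequentially. (\<integral>\<^sup>+x\<in>K. ennreal ((f x - fn n x)\<^sup>2) \<partial>lborel) < ennreal r"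
      using uniform_limitD[OF unif \<open>\<delta> > 0\<close>]
    proof eventually_elim
      fix n assume n: "\<forall>x\<in>K. dist (fn n x) (f x) < \<delta>"
      have "(\<integral>\<^sup>+x\<in>K. ennreal ((f x - fn n x)\<^sup>2) \<partial>lborel) \<le> (\<integral>\<^sup>+x. ennreal (\<delta>\<^sup>2) * indicator K x \<partial>lborel)"
      proof (rule nn_integral_mono)
        fix x
        show "ennreal ((f x - fn n x)\<^sup>2) * indicator K x \<le> ennreal (\<delta>\<^sup>2) * indicator K x"
        proof (cases "x \<in> K")
          case True
          then have "\<bar>f x - fn n x\<bar> \<le> \<bar>\<delta>\<bar>"
            using n by (auto simp: dist_real_def abs_minus_commute intro: less_imp_le less_le_trans)
          then show ?thesis
            using True by (simp add: abs_le_square_iff)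
        qed simp
      qed
      also have "\<dots> = ennreal (\<delta>\<^sup>2 * m)"
        using K' m by (simp add: nn_integral_cmult_indicator ennreal_mult)
      also have "\<dots> < ennreal r"
        using \<open>\<delta>\<^sup>2 * m < r\<close> \<open>0 < r\<close> by (simp add: ennreal_lessI)
      finally show "(\<integral>\<^sup>+x\<in>K. ennreal ((f x - fn n x)\<^sup>2) \<partial>lborel) < ennreal r" .
    qed
  qed
  ultimately show ?thesis
    using sq cont by (auto simp: L2_limit_on_def)
qed

theorem theorem2p3:
  fixes M :: "'a measure"
    and Y Y' :: "nat \<Rightarrow> 'a \<Rightarrow> real"
    and c :: "nat \<Rightarrow> real"
  assumes "prob_space M"
    and "\<And>n. n \<ge> 1 \<Longrightarrow> distributed M lborel (Y n) std_normal_density"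
    and "\<And>n. distributed M lborel (Y' n) std_normal_density"
    and "prob_space.indep_vars M (\<lambda>_. borel) Y {1..}"
    and "prob_space.indep_vars M (\<lambda>_. borel) Y' UNIV"
    and "prob_space.indep_var M
           (PiM {1..} (\<lambda>_. borel)) (\<lambda>\<omega>. \<lambda>n\<in>{1..}. Y n \<omega>)
           (PiM UNIV (\<lambda>_. borel)) (\<lambda>\<omega> n. Y' n \<omega>)"
    and "summable (\<lambda>k. (c k)\<^sup>2)"
  shows "\<exists>y :: real \<Rightarrow> 'a \<Rightarrow> real.
    stationary_periodic_gaussian M y \<and>
    mean_square_uniform_limit M (trig_process c Y Y') y \<and>
    (\<forall>s\<in>{0..1}. \<forall>t\<in>{0..1}.
       covariance_fun M y s t =
         (c 0)\<^sup>2 + (\<Sum>k. 2 * (c (Suc k))\<^sup>2 * cos (2 * real (Suc k) * pi * (s - t)))) \<and>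
    (\<forall>s\<in>{0..1}. \<forall>t\<in>{0..1}.
       summable (\<lambda>k. \<bar>2 * (c (Suc k))\<^sup>2 * cos (2 * real (Suc k) * pi * (s - t))\<bar>)) \<and>
    uniform_limit ({0..1} \<times> {0..1})
      (\<lambda>n (s, t). (c 0)\<^sup>2 + (\<Sum>k=1..n. 2 * (c k)\<^sup>2 * cos (2 * real k * pi * (s - t))))
      (\<lambda>(s, t). covariance_fun M y s t) sequentially \<and>
    L2_limit_on (lborel :: (real \<times> real) measure) ({0..1} \<times> {0..1})
      (\<lambda>n (s, t). (c 0)\<^sup>2 + (\<Sum>k=1..n. 2 * (c k)\<^sup>2 * cos (2 * real k * pi * (s - t))))
      (\<lambda>(s, t). covariance_fun M y s t)"
proof -
  interpret independent_std_normals M Y Y'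
    by (intro independent_std_normals.intro independent_std_normals_axioms.intro) (fact assms)+
  note c = assms(7)
  obtain y where y: "\<And>t. y t \<in> borel_measurable M" and "y 0 = y 1"
    and bound: "\<And>t n. (\<integral>\<^sup>+\<omega>. ennreal ((y t \<omega> - trig_process c Y Y' n t \<omega>)\<^sup>2) \<partial>M) \<le> ennreal (variance_tail c n)"
    using trig_process_mean_square_limit[OF c] by blast
  have tail: "(\<lambda>n. ennreal (variance_tail c n)) \<longlonglongrightarrow> 0"
    using tendsto_ennrealI[OF tendsto_variance_tail[OF c]] by simp
  have lim: "(\<lambda>n. \<integral>\<^sup>+\<omega>. ennreal ((y t \<omega> - trig_process c Y Y' n t \<omega>)\<^sup>2) \<partial>M) \<longlonglongrightarrow> 0" for t
    by (rule tendsto_sandwich[OF _ _ tendsto_const tail]) (auto intro!: always_eventually bound)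
  define R where "R d = (\<Sum>k. (amplitude c k)\<^sup>2 * cos (2 * real k * pi * d))" for d
  have cov: "covariance_fun M y s t = R (s - t)" for s t
    unfolding R_def by (rule covariance_fun_limit[OF c y lim])
  have gauss: "\<exists>v. centered_gaussian M v (\<lambda>\<omega>. \<Sum>t\<in>T. a t * y t \<omega>)" if "finite T" for T a
    using centered_gaussian_limit_lincomb[OF c that, where y = y and w = a and \<tau> = "\<lambda>t. t", OF y lim] by blast
  have unif: "uniform_limit UNIV
     (\<lambda>n d. \<Sum>k\<le>n. (amplitude c k)\<^sup>2 * cos (2 * real k * pi * d)) R sequentially"
    unfolding R_def by (rule uniform_limit_covariance_series[OF c])
  have "continuous_on UNIV R"
    by (rule uniform_limit_theorem[OF _ unif]) (auto intro!: always_eventually continuous_intros)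
  have gauss_rv: "gaussian_rv M (\<lambda>\<omega>. \<Sum>t\<in>T. a t * y t \<omega>)" if "finite T" for T a
    using gauss[OF that] centered_gaussian_rv by blast
  have "expectation (y t) = 0" for t
    using gauss[of "{t}" "\<lambda>_. 1"] centered_gaussian_moments(2) by auto
  then have "stationary_periodic_gaussian M y"
    unfolding stationary_periodic_gaussian_def gaussian_process_def continuously_stationary_def
    using gauss_rv \<open>continuous_on UNIV R\<close> cov \<open>y 0 = y 1\<close> by auto
  moreover have "mean_square_uniform_limit M (trig_process c Y Y') y"
    unfolding mean_square_uniform_limit_def
    by (rule tendsto_sandwich[OF _ _ tendsto_const tail]) (auto intro!: always_eventually SUP_least bound)
  moreover have "covariance_fun M y s t =
         (c 0)\<^sup>2 + (\<Sum>k. 2 * (c (Suc k))\<^sup>2 * cos (2 * real (Suc k) * pi * (s - t)))" for s t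
    unfolding cov R_def by (rule covariance_series_eq[OF c])
  moreover have "summable (\<lambda>k. \<bar>2 * (c (Suc k))\<^sup>2 * cos (2 * real (Suc k) * pi * (s - t))\<bar>)" for s t
    using summable_covariance_series[OF c, of "s - t", THEN summable_Suc_iff[THEN iffD2]]
    by (simp add: amplitude_def power_mult_distrib)
  moreover have unif2: "uniform_limit ({0..1} \<times> {0..1})
      (\<lambda>n (s, t). (c 0)\<^sup>2 + (\<Sum>k=1..n. 2 * (c k)\<^sup>2 * cos (2 * real k * pi * (s - t))))
      (\<lambda>(s, t). covariance_fun M y s t) sequentially"
    using uniform_limit_compose'[OF unif, of "\<lambda>(s, t). s - t" "{0..1} \<times> {0..1}"]
    unfolding covariance_partial_sum_eq cov by (simp add: case_prod_unfold)
  moreover have "L2_limit_on (lborel :: (real \<times> real) measure) ({0..1} \<times> {0..1})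
      (\<lambda>n (s, t). (c 0)\<^sup>2 + (\<Sum>k=1..n. 2 * (c k)\<^sup>2 * cos (2 * real k * pi * (s - t))))
      (\<lambda>(s, t). covariance_fun M y s t)"
    by (rule L2_limit_on_compact_if_uniform_limit[OF _ _ unif2])
       (auto intro!: compact_Times continuous_intros simp: case_prod_unfold)
  ultimately show ?thesis
    by (intro exI[of _ y]) blast
qed

end
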